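(* Let $c>0$ and $\Delta=(0,c]$. Let $F,G$ be distributions on $\mathbb R$ and let $H=F*G$. Suppose $H\in\mathcal S_\Delta$ and $G(x+\Delta)=o(H(x+\Delta))$ as $x\to\infty$. If $F\in\mathcal A_\Delta$ and, in addition, either $H\in\mathcal D_\Delta$ or $G(x+\Delta)=o(F(x+\Delta))$ as $x\to\infty$, then $F\in\mathcal S_\Delta$.
   Context: For $\Delta=(0,c]$ and a distribution $F$ on $\mathbb R$, $F(x+\Delta):=F((x,x+c])$. $F*G$ is the convolution and $F^{*n}$ the $n$-fold convolution. $\alpha(x)\sim\beta(x)$ means $\alpha(x)/\beta(x)\to1$ as $x\to\infty$. A non-negative measurable function $\alpha$ belongs to $\mathcal L$ if there is $x_0>0$ with $\alpha(x)>0$ for $x\ge x_0$ and, for every fixed $y>0$, $\alpha(x+y)\sim\alpha(x)$. $F\in\mathcal L_\Delta$ if $x\mapsto F(x+\Delta)$ is in $\mathcal L$; $F\in\mathcal S_\Delta$ if $F\in\mathcal L_\Delta$ and $F^{*2}(x+\Delta)\sim 2F(x+\Delta)$. A function $\alpha:\mathbb R\to\mathbb R_+$ is almost decreasing if there exist $x_0>0$ and $K>0$ such that $\alpha(x+y)\le K\alpha(x)$ for all $x>x_0$, $y>0$. $F\in\mathcal D_\Delta$ if $x\mapsto F(x+\Delta)$ is almost decreasing. A function $\alpha:\mathbb R\to\mathbb R_+$ is asymptotic to a non-increasing function if for some $x_0>0$ it is locally bounded and positive on $[x_0,\infty)$, and $\sup_{t\ge x}\alpha(t)\sim\alpha(x)$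 and $\inf_{x_0\le t\le x}\alpha(t)\sim\alpha(x)$. $F\in\mathcal A_\Delta$ if $x\mapsto F(x+\Delta)$ is asymptotic to a non-increasing function in this sense. *)

theory Defs
  imports "HOL-Probability.Probability"
begin

text \<open>
  A distribution on the real line is a measure satisfying \<open>real_distribution\<close>; \<open>F * G\<close> is the
  library's \<open>F \<star> G\<close>. The interval \<open>\<Delta> = (0, c]\<close> is represented by its length \<open>c\<close>.
  Wherever \<open>\<sim>[at_top]\<close> occurs below, the other conditions make one side eventually positive, so that
  it means convergence of the quotient to 1.
\<close>

definition interval_prob :: "real \<Rightarrow> real measure \<Rightarrow> real \<Rightarrow> real" where
  "interval_prob c F x = measure F {x<..x + c}"

definition long_tailed :: "(real \<Rightarrow> real) \<Rightarrow> bool" where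
  "long_tailed \<alpha> \<longleftrightarrow>
     \<alpha> \<in> borel_measurable borel \<and> (\<forall>x. 0 \<le> \<alpha> x) \<and>
     (\<exists>x0>0. \<forall>x\<ge>x0. 0 < \<alpha> x) \<and>
     (\<forall>y>0. (\<lambda>x. \<alpha> (x + y)) \<sim>[at_top] \<alpha>)"

definition almost_decreasing :: "(real \<Rightarrow> real) \<Rightarrow> bool" where
  "almost_decreasing \<alpha> \<longleftrightarrow>
     (\<forall>x. 0 \<le> \<alpha> x) \<and>
     (\<exists>x0>0. \<exists>K>0. \<forall>x>x0. \<forall>y>0. \<alpha> (x + y) \<le> K * \<alpha> x)"

text \<open>
  The real-valued supremum is meaningful only for sets that are bounded above. That it is finite
  for large \<open>x\<close> is implicit in the asymptotic equivalence of supremum and \<open>\<alpha>\<close>, and is stated separately here.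
  The infimum needs no such proviso, as \<open>\<alpha>\<close> is non-negative.
\<close>

definition asymptotic_to_nonincreasing :: "(real \<Rightarrow> real) \<Rightarrow> bool" where
  "asymptotic_to_nonincreasing \<alpha> \<longleftrightarrow>
     (\<forall>x. 0 \<le> \<alpha> x) \<and>
     (\<exists>x0>0.
        (\<forall>C. compact C \<and> C \<subseteq> {x0..} \<longrightarrow> bounded (\<alpha> ` C)) \<and>
        (\<forall>x\<ge>x0. 0 < \<alpha> x) \<and>
        (\<forall>\<^sub>F x in at_top. bdd_above (\<alpha> ` {x..})) \<and>
        (\<lambda>x. SUP t\<in>{x..}. \<alpha> t) \<sim>[at_top] \<alpha> \<and>
        (\<lambda>x. INF t\<in>{x0..x}. \<alpha> t) \<sim>[at_top] \<alpha>)"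

definition class_L :: "real \<Rightarrow> real measure \<Rightarrow> bool" where
  "class_L c F \<longleftrightarrow> long_tailed (interval_prob c F)"

definition class_S :: "real \<Rightarrow> real measure \<Rightarrow> bool" where
  "class_S c F \<longleftrightarrow>
     class_L c F \<and>
     interval_prob c (F \<star> F) \<sim>[at_top] (\<lambda>x. 2 * interval_prob c F x)"

definition class_D :: "real \<Rightarrow> real measure \<Rightarrow> bool" where
  "class_D c F \<longleftrightarrow> almost_decreasing (interval_prob c F)"

definition class_A :: "real \<Rightarrow> real measure \<Rightarrow> bool" where
  "class_A c F \<longleftrightarrow> asymptotic_to_nonincreasing (interval_prob c F)"

end

theory Submission
  imports Defs
begin

text \<open>
  Write \<open>f\<close>, \<open>g\<close>, \<open>h\<close> for the interval probabilities of \<open>F\<close>, \<open>G\<close> and \<open>H = F \<star> G\<close>, and let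
  \<open>X\<close>, \<open>Y\<close> be independent with distributions \<open>F\<close>, \<open>G\<close>. The theorem holds because \<open>f\<close> and \<open>h\<close> are
  asymptotically equivalent, and because equivalence to a member of \<open>\<S>\<^sub>\<Delta>\<close> is inherited by \<open>F\<close>
  as soon as \<open>f\<close> is almost monotone, in the sense that for each \<open>e > 0\<close> and all large \<open>x\<close> the
  bound \<open>f t \<le> (1 + e) * f x\<close> holds for every \<open>t \<ge> x\<close>.

  Both halves rest on one decomposition (\<open>interval_prob_convolution_split\<close>). If \<open>x \<ge> 2 * A\<close> and
  \<open>X + Y > x\<close>, then \<open>X\<close> and \<open>Y\<close> cannot both be at most \<open>A\<close>, so \<open>h x\<close> is the sum of the
  contributions of \<open>X \<le> A\<close>, of \<open>Y \<le> A\<close> and of \<open>X, Y > A\<close>.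

  \<^item> The last contribution is negligible against \<open>h\<close> once \<open>A\<close> is large (\<open>eventually_joint_tail_le\<close>).
    For two independent variables with distribution \<open>H\<close> this is what subexponentiality says. Since
    \<open>f\<close> and \<open>g\<close> are bounded by multiples of \<open>h\<close> far out, \<open>F\<close> and \<open>G\<close> can be replaced by \<open>H\<close> one
    after the other, at the cost of a constant factor and of a shift of \<open>A\<close> by \<open>c\<close>.
  \<^item> For \<open>Y \<le> A\<close>, almost monotonicity gives at most about \<open>f (x - A)\<close>.
  \<^item> For \<open>X \<le> A\<close>, the contribution integrates values \<open>g t\<close> with \<open>t \<ge> x - A\<close>. Let \<open>k\<close> be \<open>h\<close>
    or \<open>f\<close>, according to the alternative in the hypotheses. In both cases \<open>k\<close> is almost decreasing,
    is bounded by a multiple of \<open>h\<close> and dominates \<open>g\<close> in the little-o sense, so the integral is at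
    most a small multiple of \<open>k (x - A)\<close>, hence of \<open>h x\<close>.

  As \<open>h\<close> is long-tailed, shifts by \<open>A\<close> do not matter, and \<open>h\<close> is asymptotically at most \<open>f\<close>
  (\<open>convolution_le_factor\<close>). The converse bound (\<open>factor_le_convolution\<close>) comes from the mass of \<open>G\<close>
  near the origin; it precedes the first one because it provides the comparison of \<open>f\<close> with \<open>h\<close>
  used above. Finally the same decomposition of \<open>F \<star> F\<close> yields \<open>F \<in> \<S>\<^sub>\<Delta>\<close>
  (\<open>class_S_of_asymp_equiv_class_A\<close>).
\<close>

section \<open>Joint probabilities for sums falling into an interval\<close>

definition joint_interval_prob ::
    "real \<Rightarrow> real measure \<Rightarrow> real measure \<Rightarrow> real set \<Rightarrow> real set \<Rightarrow> real \<Rightarrow> real" where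
  "joint_interval_prob c F G U V x =
     measure (F \<Otimes>\<^sub>M G)
       {p. fst p \<in> U \<and> snd p \<in> V \<and> x < fst p + snd p \<and> fst p + snd p \<le> x + c}"

lemma real_distribution_convolution:
  assumes "real_distribution F" and "real_distribution G"
  shows "real_distribution (F \<star> G)"
proof -
  interpret F: real_distribution F by fact
  interpret G: real_distribution G by fact
  interpret P: pair_prob_space F G ..
  have "(\<lambda>(u, v). u + v) \<in> F \<Otimes>\<^sub>M G \<rightarrow>\<^sub>M (borel :: real measure)"
    by measurable
  then have "prob_space (F \<star> G)"
    unfolding convolution_def by (rule P.prob_space_distr)
  then show ?thesis
    by (simp add: real_distribution_def real_distribution_axioms_def)
qed

lemma interval_prob_nonneg: "0 \<le> interval_prob c F x"
  by (simp add: interval_prob_def)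

lemma borel_measurable_interval_prob:
  assumes "real_distribution F" and "0 < c"
  shows "interval_prob c F \<in> borel_measurable borel"
proof -
  interpret F: real_distribution F by fact
  have "interval_prob c F = (\<lambda>x. cdf F (x + c) - cdf F x)"
  proof
    fix x
    show "interval_prob c F x = cdf F (x + c) - cdf F x"
      using F.cdf_diff_eq[of x "x + c"] assms(2) by (simp add: interval_prob_def)
  qed
  moreover have "cdf F \<in> borel_measurable borel"
    by (rule borel_measurable_mono) (rule monoI, rule F.cdf_nondecreasing)
  ultimately show ?thesis by simp
qed

lemma sum_event_in_sets:
  fixes U V :: "real set"
  assumes "U \<in> sets borel" and "V \<in> sets borel"
  shows "{p. fst p \<in> U \<and> snd p \<in> V \<and> x < fst p + snd p \<and> fst p + snd p \<le> x + c}
    \<in> sets (borel \<Otimes>\<^sub>M borel)"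
proof -
  have [measurable]: "U \<in> sets borel" "V \<in> sets borel" by fact+
  have "{p \<in> space (borel \<Otimes>\<^sub>M borel). fst p \<in> U \<and> snd p \<in> V
      \<and> x < fst p + snd p \<and> fst p + snd p \<le> x + c} \<in> sets (borel \<Otimes>\<^sub>M borel)"
    by measurable
  then show ?thesis by (simp add: space_pair_measure)
qed

lemma joint_interval_prob_UNIV:
  assumes "real_distribution F" and "real_distribution G"
  shows "joint_interval_prob c F G UNIV UNIV x = interval_prob c (F \<star> G) x"
proof -
  interpret F: real_distribution F by fact
  interpret G: real_distribution G by fact
  have m: "(\<lambda>(u, v). u + v) \<in> F \<Otimes>\<^sub>M G \<rightarrow>\<^sub>M (borel :: real measure)"
    by measurable
  show ?thesis
    unfolding joint_interval_prob_def interval_prob_def convolution_def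
    by (subst measure_distr[OF m])
       (auto intro!: arg_cong[where f = "measure _"] simp: space_pair_measure)
qed

lemma joint_interval_prob_swap:
  assumes "real_distribution F" and "real_distribution G"
    and "U \<in> sets borel" and "V \<in> sets borel"
  shows "joint_interval_prob c F G U V x = joint_interval_prob c G F V U x"
proof -
  interpret F: real_distribution F by fact
  interpret G: real_distribution G by fact
  interpret P: pair_sigma_finite G F ..
  let ?S = "{p. fst p \<in> U \<and> snd p \<in> V \<and> x < fst p + snd p \<and> fst p + snd p \<le> x + c}"
  have S: "?S \<in> sets (F \<Otimes>\<^sub>M G)"
    using sum_event_in_sets[OF assms(3,4), of x c]
    by (simp cong: sets_pair_measure_cong)
  have "measure (F \<Otimes>\<^sub>M G) ?S = measure (distr (G \<Otimes>\<^sub>M F) (F \<Otimes>\<^sub>M G) (\<lambda>(x, y). (y, x))) ?S"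
    by (subst pair_sigma_finite.distr_pair_swap[of F G]) (unfold_locales, simp)
  also have "\<dots> = measure (G \<Otimes>\<^sub>M F)
      {p. fst p \<in> V \<and> snd p \<in> U \<and> x < fst p + snd p \<and> fst p + snd p \<le> x + c}"
    by (subst measure_distr[OF _ S])
       (auto intro!: arg_cong[where f = "measure _"] simp: space_pair_measure add.commute)
  finally show ?thesis by (simp add: joint_interval_prob_def)
qed

text \<open>
  Conditioning on the first coordinate. Every estimate below compares the integrands pointwise,
  that is, for a fixed value of one summand.
\<close>

lemma joint_interval_prob_integral:
  assumes "real_distribution F" and "real_distribution G"
    and "U \<in> sets borel" and "V \<in> sets borel"
  shows "integrable F (\<lambda>u. indicator U u * measure G (V \<inter> {x - u<..x - u + c}))" (is ?int)
    and "joint_interval_prob c F G U V x =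
      (\<integral>u. indicator U u * measure G (V \<inter> {x - u<..x - u + c}) \<partial>F)" (is ?eq)
proof -
  interpret F: real_distribution F by fact
  interpret G: real_distribution G by fact
  interpret P: pair_prob_space F G ..
  let ?S = "{p. fst p \<in> U \<and> snd p \<in> V \<and> x < fst p + snd p \<and> fst p + snd p \<le> x + c}"
  have S: "?S \<in> sets (F \<Otimes>\<^sub>M G)"
    using sum_event_in_sets[OF assms(3,4), of x c]
    by (simp cong: sets_pair_measure_cong)
  have cut: "measure G (Pair u -` ?S) = indicator U u * measure G (V \<inter> {x - u<..x - u + c})" for u
    by (auto simp: indicator_def intro!: arg_cong[where f = "measure G"])
  have "(\<lambda>u. measure G (Pair u -` ?S)) \<in> borel_measurable F"
    unfolding measure_def using G.measurable_emeasure_Pair[OF S] by measurable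
  then have "(\<lambda>u. indicator U u * measure G (V \<inter> {x - u<..x - u + c})) \<in> borel_measurable F"
    unfolding cut .
  then show int: ?int
    by (rule F.integrable_const_bound[where B = 1, rotated])
       (auto simp: indicator_def)
  have "emeasure (F \<Otimes>\<^sub>M G) ?S = (\<integral>\<^sup>+u. emeasure G (Pair u -` ?S) \<partial>F)"
    by (rule G.emeasure_pair_measure_alt[OF S])
  also have "\<dots> = (\<integral>\<^sup>+u. ennreal (indicator U u * measure G (V \<inter> {x - u<..x - u + c})) \<partial>F)"
    by (simp only: G.emeasure_eq_measure cut)
  also have "\<dots> = ennreal (\<integral>u. indicator U u * measure G (V \<inter> {x - u<..x - u + c}) \<partial>F)"
    by (rule nn_integral_eq_integral[OF int]) simp
  finally show ?eq
    unfolding joint_interval_prob_def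
    by (simp add: P.emeasure_eq_measure integral_nonneg_AE)
qed

lemma joint_interval_prob_mono_section:
  assumes "real_distribution F" and "real_distribution G" and "real_distribution H"
    and "U \<in> sets borel" and "V \<in> sets borel" and "W \<in> sets borel"
    and le: "\<And>u. u \<in> U \<Longrightarrow>
      measure G (V \<inter> {x - u<..x - u + c}) \<le> C * measure H (W \<inter> {x - u<..x - u + c})"
  shows "joint_interval_prob c F G U V x \<le> C * joint_interval_prob c F H U W x"
proof -
  have "(\<integral>u. indicator U u * measure G (V \<inter> {x - u<..x - u + c}) \<partial>F)
      \<le> (\<integral>u. C * (indicator U u * measure H (W \<inter> {x - u<..x - u + c})) \<partial>F)"
    using assms(1-6)
    by (intro integral_mono integrable_mult_right joint_interval_prob_integral(1))
       (auto simp: indicator_def intro: le)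
  then show ?thesis
    using assms by (simp add: joint_interval_prob_integral(2))
qed

lemma joint_interval_prob_le:
  assumes "real_distribution F" and "real_distribution G" and "U \<in> sets borel" and "0 \<le> B"
    and le: "\<And>u. u \<in> U \<Longrightarrow> interval_prob c G (x - u) \<le> B"
  shows "joint_interval_prob c F G U UNIV x \<le> B"
proof -
  interpret F: real_distribution F by fact
  have "(\<integral>u. indicator U u * measure G (UNIV \<inter> {x - u<..x - u + c}) \<partial>F) \<le> (\<integral>u. B \<partial>F)"
    using assms(1-4) le
    by (intro integral_mono joint_interval_prob_integral(1))
       (auto simp: indicator_def interval_prob_def)
  then show ?thesis
    using assms by (simp add: joint_interval_prob_integral(2) F.prob_space[simplified])
qed

lemma joint_interval_prob_ge:
  assumes "real_distribution F" and "real_distribution G" and "U \<in> sets borel" and "0 \<le> B"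
    and ge: "\<And>u. u \<in> U \<Longrightarrow> B \<le> interval_prob c G (x - u)"
  shows "measure F U * B \<le> joint_interval_prob c F G U UNIV x"
proof -
  interpret F: real_distribution F by fact
  have "(\<integral>u. indicator U u * B \<partial>F)
      \<le> (\<integral>u. indicator U u * measure G (UNIV \<inter> {x - u<..x - u + c}) \<partial>F)"
  proof (rule integral_mono)
    show "integrable F (\<lambda>u. indicator U u * B)"
      using assms(3)
      by (intro integrable_mult_left integrable_real_indicator)
         (auto simp: F.emeasure_eq_measure)
    show "integrable F (\<lambda>u. indicator U u * measure G (UNIV \<inter> {x - u<..x - u + c}))"
      using assms by (intro joint_interval_prob_integral(1)) auto
  qed (use ge in \<open>auto simp: indicator_def interval_prob_def\<close>)
  then show ?thesis
    using assms by (simp add: joint_interval_prob_integral(2))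
qed

lemma joint_interval_prob_mono:
  assumes "real_distribution F" and "real_distribution G"
    and "U' \<in> sets borel" and "V' \<in> sets borel" and "U \<subseteq> U'" and "V \<subseteq> V'"
  shows "joint_interval_prob c F G U V x \<le> joint_interval_prob c F G U' V' x"
proof -
  interpret F: real_distribution F by fact
  interpret G: real_distribution G by fact
  interpret P: pair_prob_space F G ..
  show ?thesis
    unfolding joint_interval_prob_def
    using sum_event_in_sets[OF assms(3,4), of x c] assms(5,6)
    by (intro P.finite_measure_mono) (auto cong: sets_pair_measure_cong)
qed

text \<open>
  Since \<open>x \<ge> 2 * A\<close>, two summands that are both at most \<open>A\<close> cannot have a sum exceeding \<open>x\<close>; hence the
  first two events are disjoint. The second term is written with the factors exchanged, so that the
  bounded summand always comes first.
\<close>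

lemma interval_prob_convolution_split:
  assumes "real_distribution F" and "real_distribution G" and "2 * A \<le> x"
  shows "interval_prob c (F \<star> G) x =
    joint_interval_prob c F G {..A} UNIV x + joint_interval_prob c G F {..A} UNIV x
      + joint_interval_prob c F G {A<..} {A<..} x"
proof -
  interpret F: real_distribution F by fact
  interpret G: real_distribution G by fact
  interpret P: pair_prob_space F G ..
  let ?S = "\<lambda>U V. {p. fst p \<in> U \<and> snd p \<in> V \<and> x < fst p + snd p \<and> fst p + snd p \<le> x + c}"
  have S: "?S U V \<in> sets (F \<Otimes>\<^sub>M G)" if "U \<in> sets borel" "V \<in> sets borel" for U V
    using sum_event_in_sets[OF that, of x c] by (simp cong: sets_pair_measure_cong)
  have eq: "?S UNIV UNIV = ?S {..A} UNIV \<union> ?S UNIV {..A} \<union> ?S {A<..} {A<..}"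
    by auto
  have "measure (F \<Otimes>\<^sub>M G) (?S UNIV UNIV)
      = measure (F \<Otimes>\<^sub>M G) (?S {..A} UNIV \<union> ?S UNIV {..A})
        + measure (F \<Otimes>\<^sub>M G) (?S {A<..} {A<..})"
    unfolding eq by (intro P.finite_measure_Union sets.Un S) auto
  also have "measure (F \<Otimes>\<^sub>M G) (?S {..A} UNIV \<union> ?S UNIV {..A})
      = measure (F \<Otimes>\<^sub>M G) (?S {..A} UNIV) + measure (F \<Otimes>\<^sub>M G) (?S UNIV {..A})"
    using assms(3) by (intro P.finite_measure_Union S) auto
  finally show ?thesis
    using joint_interval_prob_UNIV[OF assms(1,2), of c x]
      joint_interval_prob_swap[OF assms(1,2), of UNIV "{..A}" c x]
    by (simp add: joint_interval_prob_def)
qed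

section \<open>Asymptotic equivalence and long tails\<close>

lemma asymp_equiv_at_topD:
  fixes f g :: "real \<Rightarrow> real"
  assumes "f \<sim>[at_top] g" and "\<forall>\<^sub>F x in at_top. 0 < g x" and "0 < e"
  shows "\<forall>\<^sub>F x in at_top. (1 - e) * g x \<le> f x \<and> f x \<le> (1 + e) * g x"
proof -
  have "\<forall>\<^sub>F x in at_top. dist (if f x = 0 \<and> g x = 0 then 1 else f x / g x) 1 < e"
    using assms(1) tendstoD[OF _ assms(3)] unfolding asymp_equiv_def by blast
  with assms(2) show ?thesis
  proof eventually_elim
    case (elim x)
    then have "1 - e < f x / g x" and "f x / g x < 1 + e"
      by (auto simp: dist_real_def split: if_splits)
    with elim show ?case
      by (simp add: pos_less_divide_eq pos_divide_less_eq)
  qed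
qed

lemma asymp_equiv_at_topI:
  fixes f g :: "real \<Rightarrow> real"
  assumes pos: "\<forall>\<^sub>F x in at_top. 0 < g x"
    and lower: "\<And>e. 0 < e \<Longrightarrow> \<forall>\<^sub>F x in at_top. (1 - e) * g x \<le> f x"
    and upper: "\<And>e. 0 < e \<Longrightarrow> \<forall>\<^sub>F x in at_top. f x \<le> (1 + e) * g x"
  shows "f \<sim>[at_top] g"
proof (rule asymp_equivI', rule tendstoI)
  fix e :: real assume "0 < e"
  then have e: "0 < e / 2" "e / 2 < e" by auto
  show "\<forall>\<^sub>F x in at_top. dist (f x / g x) 1 < e"
    using pos lower[OF e(1)] upper[OF e(1)]
  proof eventually_elim
    case (elim x)
    then have "1 - e / 2 \<le> f x / g x" and "f x / g x \<le> 1 + e / 2"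
      by (simp_all only: pos_le_divide_eq pos_divide_le_eq)
    with e(2) show ?case by (simp add: dist_real_def abs_less_iff)
  qed
qed

lemma eventually_at_top_shift:
  fixes a :: real
  assumes "\<forall>\<^sub>F x in at_top. P x"
  shows "\<forall>\<^sub>F x in at_top. P (x + a)"
proof -
  from assms obtain N where "\<forall>x\<ge>N. P x"
    by (auto simp: eventually_at_top_linorder)
  then show ?thesis
    by (auto simp: eventually_at_top_linorder intro!: exI[of _ "N - a"])
qed

lemma long_tailed_shift:
  assumes "long_tailed \<alpha>"
  shows "(\<lambda>x. \<alpha> (x + y)) \<sim>[at_top] \<alpha>"
proof -
  consider "0 < y" | "y = 0" | "y < 0" by linarith
  then show ?thesis
  proof cases
    case 3
    have "filterlim (\<lambda>x. x + y) at_top at_top"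
      by (simp add: filterlim_at_top eventually_at_top_shift)
    moreover have "(\<lambda>x. \<alpha> (x + - y)) \<sim>[at_top] \<alpha>"
      using assms 3 unfolding long_tailed_def by (simp del: add_uminus_conv_diff)
    ultimately have "(\<lambda>x. \<alpha> (x + y + - y)) \<sim>[at_top] (\<lambda>x. \<alpha> (x + y))"
      by (rule asymp_equiv_compose'[rotated])
    then show ?thesis by (simp add: asymp_equiv_sym)
  qed (use assms in \<open>auto simp: long_tailed_def\<close>)
qed

lemma long_tailed_eventually_pos:
  "long_tailed \<alpha> \<Longrightarrow> \<forall>\<^sub>F x in at_top. 0 < \<alpha> x"
  unfolding long_tailed_def eventually_at_top_linorder by blast

text \<open>
  For each fixed \<open>u\<close>, the ratio of \<open>interval_prob c H (x - u)\<close> to \<open>interval_prob c H x\<close> tends to 1,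
  so integrating over \<open>u \<in> U\<close> should give \<open>measure K U\<close> in the limit. The set \<open>U\<close> may be unbounded
  and the ratio need not be bounded, but for a lower estimate the ratio can be truncated at 1, and
  dominated convergence applies.
\<close>

lemma eventually_ge_joint_of_long_tailed:
  assumes K: "real_distribution K" and H: "real_distribution H"
    and tail: "class_L c H" and U: "U \<in> sets borel" and r: "r < measure K U"
  shows "\<forall>\<^sub>F x in at_top. r * interval_prob c H x \<le> joint_interval_prob c K H U UNIV x"
proof -
  interpret K: real_distribution K by fact
  let ?h = "interval_prob c H"
  have lt: "long_tailed ?h" using tail by (simp add: class_L_def)
  then have [measurable]: "?h \<in> borel_measurable borel" by (simp add: long_tailed_def)
  have [measurable]: "U \<in> sets borel" by fact
  have lim: "((\<lambda>x. indicator U u * min 1 (?h (x - u) / ?h x)) \<longlongrightarrow> indicator U u) at_top" for u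
  proof -
    have "((\<lambda>x. ?h (x - u) / ?h x) \<longlongrightarrow> 1) at_top"
    proof (rule Lim_transform_eventually)
      show "((\<lambda>x. if ?h (x - u) = 0 \<and> ?h x = 0 then 1 else ?h (x - u) / ?h x) \<longlongrightarrow> 1) at_top"
        using long_tailed_shift[OF lt, of "- u"] by (simp add: asymp_equiv_def)
      show "\<forall>\<^sub>F x in at_top. (if ?h (x - u) = 0 \<and> ?h x = 0 then 1 else ?h (x - u) / ?h x)
          = ?h (x - u) / ?h x"
        using long_tailed_eventually_pos[OF lt] by eventually_elim auto
    qed
    then have "((\<lambda>x. indicator U u * min 1 (?h (x - u) / ?h x))
        \<longlongrightarrow> indicator U u * min 1 1) at_top"
      by (intro tendsto_intros)
    then show ?thesis by simp
  qed
  have bound: "norm (indicator U u * min 1 (?h (x - u) / ?h x)) \<le> 1" for x u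
    by (auto simp: indicator_def interval_prob_nonneg min_def)
  have "((\<lambda>x. \<integral>u. indicator U u * min 1 (?h (x - u) / ?h x) \<partial>K)
      \<longlongrightarrow> (\<integral>u. indicator U u \<partial>K)) at_top"
    by (rule integral_dominated_convergence_at_top[where w = "\<lambda>_. 1"])
       (use lim bound in auto)
  then have "\<forall>\<^sub>F x in at_top. r < (\<integral>u. indicator U u * min 1 (?h (x - u) / ?h x) \<partial>K)"
    using r by (auto dest: order_tendstoD(1))
  with long_tailed_eventually_pos[OF lt] show ?thesis
  proof eventually_elim
    case (elim x)
    have int: "integrable K (\<lambda>u. indicator U u * min 1 (?h (x - u) / ?h x))"
      by (rule K.integrable_const_bound[where B = 1]) (use bound in auto)
    have "r * ?h x \<le> (\<integral>u. indicator U u * min 1 (?h (x - u) / ?h x) \<partial>K) * ?h x"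
      using elim by (intro mult_right_mono) auto
    also have "\<dots> = (\<integral>u. indicator U u * min 1 (?h (x - u) / ?h x) * ?h x \<partial>K)"
      by simp
    also have "\<dots> \<le> (\<integral>u. indicator U u * measure H (UNIV \<inter> {x - u<..x - u + c}) \<partial>K)"
      using elim(1)
      by (intro integral_mono integrable_mult_left[OF int] joint_interval_prob_integral(1) K H U)
         (auto simp: indicator_def min_def interval_prob_def[of c H "x - _"] field_simps
           simp flip: interval_prob_def)
    also have "\<dots> = joint_interval_prob c K H U UNIV x"
      by (simp add: joint_interval_prob_integral(2)[OF K H U])
    finally show ?case .
  qed
qed

section \<open>Two simultaneously large summands\<close>

text \<open>
  The convolution square is asymptotically twice \<open>interval_prob c H\<close>, and each of the two events
  where one summand is at most \<open>A\<close> already accounts for nearly one of these two copies. Little is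
  left for the event where both summands are large.
\<close>

lemma eventually_joint_tail_le_of_class_S:
  assumes H: "real_distribution H" and S: "class_S c H" and "0 < e"
  shows "\<exists>A0. \<forall>A\<ge>A0. \<forall>\<^sub>F x in at_top.
    joint_interval_prob c H H {A<..} {A<..} x \<le> e * interval_prob c H x"
proof -
  interpret H: real_distribution H by fact
  have L: "class_L c H" using S by (simp add: class_S_def)
  then have pos: "\<forall>\<^sub>F x in at_top. 0 < interval_prob c H x"
    by (simp add: class_L_def long_tailed_eventually_pos)
  have "(1 - e / 4) < 1" using \<open>0 < e\<close> by simp
  then have "\<forall>\<^sub>F A in at_top. 1 - e / 4 < cdf H A"
    by (rule order_tendstoD(1)[OF H.cdf_lim_at_top_prob])
  then obtain A0 where A0: "\<And>A. A0 \<le> A \<Longrightarrow> 1 - e / 4 < cdf H A"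
    by (auto simp: eventually_at_top_linorder)
  show ?thesis
  proof (intro exI[of _ A0] allI impI)
    fix A assume "A0 \<le> A"
    then have "1 - e / 4 < measure H {..A}" using A0 by (simp add: cdf_def)
    then have lower: "\<forall>\<^sub>F x in at_top.
        (1 - e / 4) * interval_prob c H x \<le> joint_interval_prob c H H {..A} UNIV x"
      by (intro eventually_ge_joint_of_long_tailed H L) auto
    have upper: "\<forall>\<^sub>F x in at_top. (1 - e / 4) * (2 * interval_prob c H x) \<le> interval_prob c (H \<star> H) x
        \<and> interval_prob c (H \<star> H) x \<le> (1 + e / 4) * (2 * interval_prob c H x)"
      using S pos \<open>0 < e\<close> by (intro asymp_equiv_at_topD) (auto simp: class_S_def)
    show "\<forall>\<^sub>F x in at_top. joint_interval_prob c H H {A<..} {A<..} x \<le> e * interval_prob c H x"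
      using lower upper eventually_ge_at_top[of "2 * A"]
    proof eventually_elim
      case (elim x)
      then show ?case
        using interval_prob_convolution_split[OF H H, of A x c] by (simp add: algebra_simps)
    qed
  qed
qed

text \<open>
  An interval of length \<open>c\<close> that meets \<open>{A<..}\<close> lies inside \<open>{A - c<..}\<close>. Widening the half-line
  by \<open>c\<close> on the right-hand side thus turns a truncated interval into a full one, for which the
  hypothesis is available.
\<close>

lemma joint_interval_prob_tail_comparison:
  assumes "real_distribution F" and "real_distribution G" and H: "real_distribution H"
    and "U \<in> sets borel" and "0 \<le> C"
    and le: "\<And>t. A - c \<le> t \<Longrightarrow> interval_prob c G t \<le> C * interval_prob c H t"
  shows "joint_interval_prob c F G U {A<..} x \<le> C * joint_interval_prob c F H U {A - c<..} x"
proof (rule joint_interval_prob_mono_section)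
  fix u
  interpret G: real_distribution G by fact
  show "measure G ({A<..} \<inter> {x - u<..x - u + c})
      \<le> C * measure H ({A - c<..} \<inter> {x - u<..x - u + c})"
  proof (cases "x - u + c \<le> A")
    case True
    then have "{A<..} \<inter> {x - u<..x - u + c} = {}" by auto
    with \<open>0 \<le> C\<close> show ?thesis by simp
  next
    case False
    have "measure G ({A<..} \<inter> {x - u<..x - u + c}) \<le> interval_prob c G (x - u)"
      unfolding interval_prob_def by (intro G.finite_measure_mono) auto
    also have "\<dots> \<le> C * interval_prob c H (x - u)"
      using False by (intro le) simp
    also have "{x - u<..x - u + c} = {A - c<..} \<inter> {x - u<..x - u + c}"
      using False by auto
    then have "interval_prob c H (x - u) = measure H ({A - c<..} \<inter> {x - u<..x - u + c})"
      by (simp add: interval_prob_def)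
    finally show ?thesis .
  qed
qed (use assms in auto)

text \<open>
  Replacing first \<open>G\<close> and then \<open>F\<close> by \<open>H\<close> reduces the claim to two independent copies of \<open>H\<close>.
  The swap between the two replacements puts the factor to be replaced into second position.
\<close>

lemma eventually_joint_tail_le:
  assumes F: "real_distribution F" and G: "real_distribution G" and H: "real_distribution H"
    and S: "class_S c H" and "0 \<le> C" and "0 < e"
    and f: "\<forall>\<^sub>F x in at_top. interval_prob c F x \<le> C * interval_prob c H x"
    and g: "\<forall>\<^sub>F x in at_top. interval_prob c G x \<le> C * interval_prob c H x"
  shows "\<exists>A0. \<forall>A\<ge>A0. \<forall>\<^sub>F x in at_top.
    joint_interval_prob c F G {A<..} {A<..} x \<le> e * interval_prob c H x"
proof -
  have "\<forall>\<^sub>F x in at_top. interval_prob c F x \<le> C * interval_prob c H x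
      \<and> interval_prob c G x \<le> C * interval_prob c H x"
    using f g by eventually_elim simp
  then obtain x0 where x0: "\<And>t. x0 \<le> t \<Longrightarrow> interval_prob c F t \<le> C * interval_prob c H t"
      "\<And>t. x0 \<le> t \<Longrightarrow> interval_prob c G t \<le> C * interval_prob c H t"
    by (auto simp: eventually_at_top_linorder)
  \<comment> \<open>The two replacements cost a factor \<open>C * C\<close>; adding 1 avoids division by zero.\<close>
  define d where "d = e / (C * C + 1)"
  have "0 < C * C + 1" using \<open>0 \<le> C\<close> by (intro add_nonneg_pos) auto
  then have d: "0 < d" "C * C * d \<le> e"
    using \<open>0 < e\<close> by (auto simp: d_def field_simps)
  obtain A0 where A0: "\<And>A. A0 \<le> A \<Longrightarrow> \<forall>\<^sub>F x in at_top.
      joint_interval_prob c H H {A<..} {A<..} x \<le> d * interval_prob c H x"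
    using eventually_joint_tail_le_of_class_S[OF H S d(1)] by blast
  show ?thesis
  proof (intro exI[of _ "max A0 x0 + c"] allI impI)
    fix A assume A: "max A0 x0 + c \<le> A"
    have cmp: "joint_interval_prob c F G {A<..} {A<..} x
        \<le> C * (C * joint_interval_prob c H H {A - c<..} {A - c<..} x)" for x
    proof -
      have "joint_interval_prob c F G {A<..} {A<..} x
          \<le> C * joint_interval_prob c F H {A<..} {A - c<..} x"
        using A x0(2) by (intro joint_interval_prob_tail_comparison F G H \<open>0 \<le> C\<close>) auto
      also have "joint_interval_prob c F H {A<..} {A - c<..} x
          = joint_interval_prob c H F {A - c<..} {A<..} x"
        by (intro joint_interval_prob_swap F H) auto
      also have "joint_interval_prob c H F {A - c<..} {A<..} x
          \<le> C * joint_interval_prob c H H {A - c<..} {A - c<..} x"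
        using A x0(1) by (intro joint_interval_prob_tail_comparison F G H \<open>0 \<le> C\<close>) auto
      finally show ?thesis using \<open>0 \<le> C\<close> by (simp add: mult_left_mono)
    qed
    have "A0 \<le> A - c" using A by simp
    from A0[OF this]
    show "\<forall>\<^sub>F x in at_top. joint_interval_prob c F G {A<..} {A<..} x \<le> e * interval_prob c H x"
    proof eventually_elim
      case (elim x)
      have "joint_interval_prob c F G {A<..} {A<..} x \<le> C * (C * (d * interval_prob c H x))"
        by (rule order_trans[OF cmp]) (intro mult_left_mono elim \<open>0 \<le> C\<close>)
      also have "\<dots> = C * C * d * interval_prob c H x" by simp
      also have "\<dots> \<le> e * interval_prob c H x"
        by (intro mult_right_mono d interval_prob_nonneg)
      finally show ?case .
    qed
  qed
qed

section \<open>One bounded summand\<close>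

text \<open>
  If the first summand is at most \<open>A\<close>, the second one has to reach an interval starting at or beyond
  \<open>x - A\<close>, so a bound on all later interval probabilities suffices.
\<close>

lemma eventually_joint_atMost_le:
  assumes F: "real_distribution F" and G: "real_distribution G"
    and le: "\<forall>\<^sub>F x in at_top. \<forall>t\<ge>x. interval_prob c G t \<le> \<beta> x"
  shows "\<forall>\<^sub>F x in at_top. joint_interval_prob c F G {..A} UNIV x \<le> \<beta> (x - A)"
  using eventually_at_top_shift[OF le, of "- A"]
proof eventually_elim
  case (elim x)
  have "0 \<le> interval_prob c G (x - A)" by (rule interval_prob_nonneg)
  also have "\<dots> \<le> \<beta> (x - A)" using elim by simp
  finally show ?case
    using elim by (intro joint_interval_prob_le F G) auto
qed

text \<open>
  The supremum over \<open>{x..}\<close> bounds every later value, and it is equivalent to the value at \<open>x\<close>.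
  In this form membership in \<open>\<A>\<^sub>\<Delta>\<close> enters the estimates.
\<close>

lemma class_A_eventually_almost_monotone:
  assumes "class_A c F" and "0 < e"
  shows "\<forall>\<^sub>F x in at_top. \<forall>t\<ge>x. interval_prob c F t \<le> (1 + e) * interval_prob c F x"
proof -
  let ?f = "interval_prob c F"
  obtain x0 where pos: "\<forall>x\<ge>x0. 0 < ?f x"
    and bdd: "\<forall>\<^sub>F x in at_top. bdd_above (?f ` {x..})"
    and sup: "(\<lambda>x. SUP t\<in>{x..}. ?f t) \<sim>[at_top] ?f"
    using assms(1) unfolding class_A_def asymptotic_to_nonincreasing_def by blast
  have "\<forall>\<^sub>F x in at_top. 0 < ?f x"
    using pos unfolding eventually_at_top_linorder by blast
  from asymp_equiv_at_topD[OF sup this assms(2)] bdd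
  show ?thesis
  proof eventually_elim
    case (elim x)
    show ?case
    proof (intro allI impI)
      fix t assume "x \<le> t"
      then have "?f t \<le> (SUP t\<in>{x..}. ?f t)"
        using elim by (intro cSUP_upper) auto
      with elim show "?f t \<le> (1 + e) * ?f x" by simp
    qed
  qed
qed

lemma class_A_almost_decreasing:
  assumes "class_A c F"
  shows "almost_decreasing (interval_prob c F)"
proof -
  have "\<forall>\<^sub>F x in at_top. \<forall>t\<ge>x. interval_prob c F t \<le> (1 + 1) * interval_prob c F x"
    by (rule class_A_eventually_almost_monotone[OF assms]) simp
  then obtain N where N: "\<And>x t. N \<le> x \<Longrightarrow> x \<le> t \<Longrightarrow> interval_prob c F t \<le> 2 * interval_prob c F x"
    unfolding eventually_at_top_linorder by auto
  show ?thesis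
    unfolding almost_decreasing_def
    by (intro conjI allI interval_prob_nonneg exI[of _ "max 1 N"] exI[of _ 2]) (auto intro: N)
qed

text \<open>
  Little-o compares \<open>g\<close> and \<open>k\<close> at the same point only. That \<open>k\<close> is almost decreasing upgrades this
  to a bound on all of \<open>g\<close> beyond \<open>x\<close>, as \<open>eventually_joint_atMost_le\<close> requires.
\<close>

lemma smallo_almost_decreasing_bound:
  fixes g k :: "real \<Rightarrow> real"
  assumes small: "g \<in> o[at_top](k)" and k: "almost_decreasing k" and "0 < e"
  shows "\<forall>\<^sub>F x in at_top. \<forall>t\<ge>x. g t \<le> e * k x"
proof -
  obtain x0 K0 where nonneg: "\<And>x. 0 \<le> k x"
    and K0: "\<And>x y. x0 < x \<Longrightarrow> 0 < y \<Longrightarrow> k (x + y) \<le> K0 * k x"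
    using k unfolding almost_decreasing_def by blast
  \<comment> \<open>A constant of at least 1 extends the bound to \<open>t = x\<close>.\<close>
  define K where "K = max K0 1"
  have K: "k t \<le> K * k x" if "x0 < x" "x \<le> t" for x t
  proof (cases "t = x")
    case True
    then show ?thesis using mult_right_mono[OF _ nonneg[of x], of 1 K] by (simp add: K_def)
  next
    case False
    then have "k (x + (t - x)) \<le> K0 * k x" using that by (intro K0) auto
    also have "\<dots> \<le> K * k x" by (intro mult_right_mono nonneg) (simp add: K_def)
    finally show ?thesis by simp
  qed
  have "0 < K" by (simp add: K_def)
  then have "\<forall>\<^sub>F t in at_top. norm (g t) \<le> (e / K) * norm (k t)"
    using small \<open>0 < e\<close> by (intro landau_o.smallD) auto
  then obtain N where N: "\<And>t. N \<le> t \<Longrightarrow> norm (g t) \<le> (e / K) * norm (k t)"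
    by (auto simp: eventually_at_top_linorder)
  show ?thesis
    using eventually_ge_at_top[of N] eventually_gt_at_top[of x0]
  proof eventually_elim
    case (elim x)
    show ?case
    proof (intro allI impI)
      fix t assume t: "x \<le> t"
      have "g t \<le> (e / K) * k t"
        using N[of t] elim t nonneg[of t] by simp
      also have "\<dots> \<le> (e / K) * (K * k x)"
        using \<open>0 < e\<close> \<open>0 < K\<close> elim t by (intro mult_left_mono K) auto
      also have "\<dots> = e * k x" using \<open>0 < K\<close> by simp
      finally show "g t \<le> e * k x" .
    qed
  qed
qed

section \<open>Equivalence of a convolution and its almost monotone factor\<close>

lemma eventually_central_mass:
  assumes "real_distribution G" and "0 < d"
  shows "\<exists>A>0. 1 - d < measure G {-A<..A}"
proof -
  interpret G: real_distribution G by fact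
  have "((\<lambda>A. cdf G A - cdf G (- A)) \<longlongrightarrow> 1 - 0) at_top"
    by (intro tendsto_diff G.cdf_lim_at_top_prob
        filterlim_compose[OF G.cdf_lim_at_bot filterlim_uminus_at_bot_at_top])
  then have "\<forall>\<^sub>F A in at_top. 1 - d < cdf G A - cdf G (- A)"
    using assms(2) by (intro order_tendstoD(1)) auto
  then have "\<forall>\<^sub>F A in at_top. 0 < A \<and> 1 - d < cdf G A - cdf G (- A)"
    using eventually_gt_at_top[of 0] by eventually_elim simp
  then obtain A where "0 < A" "1 - d < cdf G A - cdf G (- A)"
    by (auto simp: eventually_at_top_linorder)
  with G.cdf_diff_eq[of "- A" A] show ?thesis by auto
qed

text \<open>
  Nearly all mass of \<open>G\<close> lies in some \<open>{-B<..B}\<close>. If the second summand is there and the sum falls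
  into the interval at \<open>x - B\<close>, the first summand falls into an interval starting before \<open>x\<close>, whose
  probability is at least about \<open>f x\<close> because \<open>f\<close> is almost monotone. Thus \<open>h (x - B)\<close> is
  asymptotically at least \<open>f x\<close>, and \<open>h\<close> being long-tailed removes the shift.
\<close>

lemma factor_le_convolution:
  assumes F: "real_distribution F" and G: "real_distribution G"
    and A: "class_A c F" and L: "class_L c (F \<star> G)" and "0 < e"
  shows "\<forall>\<^sub>F x in at_top. interval_prob c F x \<le> (1 + e) * interval_prob c (F \<star> G) x"
proof -
  let ?f = "interval_prob c F" and ?h = "interval_prob c (F \<star> G)"
  \<comment> \<open>Passing from \<open>f x\<close> to \<open>h x\<close> costs one factor \<open>1 + d\<close> for almost monotonicity, one for the shift of
    \<open>h\<close>, and \<open>1 / (1 - d)\<close> for the mass of \<open>G\<close> outside \<open>{-B<..B}\<close>.\<close>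
  define d where "d = min 1 e / 8"
  have d: "0 < d" "d < 1" "(1 + d) * (1 + d) \<le> (1 + e) * (1 - d)"
  proof -
    show d: "0 < d" "d < 1" using \<open>0 < e\<close> by (auto simp: d_def)
    have "d * d \<le> d * (1 / 8)" using d by (intro mult_left_mono) (auto simp: d_def)
    moreover have "(1 + 8 * d) * (1 - d) - (1 + d) * (1 + d) = 5 * d - 9 * (d * d)"
      by (simp add: algebra_simps)
    ultimately have "(1 + d) * (1 + d) \<le> (1 + 8 * d) * (1 - d)"
      using d by linarith
    also have "\<dots> \<le> (1 + e) * (1 - d)"
      using d by (intro mult_right_mono) (auto simp: d_def)
    finally show "(1 + d) * (1 + d) \<le> (1 + e) * (1 - d)" .
  qed
  obtain B where B: "0 < B" "1 - d < measure G {-B<..B}"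
    using eventually_central_mass[OF G d(1)] by blast
  obtain N where N: "\<And>s t. N \<le> s \<Longrightarrow> s \<le> t \<Longrightarrow> ?f t \<le> (1 + d) * ?f s"
    using class_A_eventually_almost_monotone[OF A d(1)]
    unfolding eventually_at_top_linorder by blast
  have "\<forall>\<^sub>F x in at_top. (1 - d) * ?h x \<le> ?h (x + - B) \<and> ?h (x + - B) \<le> (1 + d) * ?h x"
    using L d(1) unfolding class_L_def
    by (intro asymp_equiv_at_topD long_tailed_shift long_tailed_eventually_pos)
  then show ?thesis
    using eventually_ge_at_top[of "N + 2 * B"]
  proof eventually_elim
    case (elim x)
    have "(1 - d) * (?f x / (1 + d)) \<le> measure G {-B<..B} * (?f x / (1 + d))"
      using B(2) d by (intro mult_right_mono) (auto simp: interval_prob_nonneg)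
    also have "\<dots> \<le> joint_interval_prob c G F {-B<..B} UNIV (x - B)"
    proof (intro joint_interval_prob_ge G F)
      fix u assume "u \<in> {-B<..B}"
      then have "?f x \<le> (1 + d) * ?f (x - B - u)"
        using elim(2) by (intro N) auto
      then show "?f x / (1 + d) \<le> ?f (x - B - u)"
        using d by (simp add: field_simps)
    qed (use d in \<open>auto simp: interval_prob_nonneg\<close>)
    also have "\<dots> \<le> joint_interval_prob c G F UNIV UNIV (x - B)"
      by (intro joint_interval_prob_mono G F) auto
    also have "\<dots> = ?h (x - B)"
      by (simp add: joint_interval_prob_swap[OF G F] joint_interval_prob_UNIV[OF F G])
    also have "\<dots> \<le> (1 + d) * ?h x" using elim(1) by simp
    finally have "(1 - d) * ?f x \<le> (1 + d) * (1 + d) * ?h x"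
      using d by (simp add: field_simps)
    also have "\<dots> \<le> (1 + e) * (1 - d) * ?h x"
      by (intro mult_right_mono d interval_prob_nonneg)
    finally have "(1 - d) * ?f x \<le> (1 - d) * ((1 + e) * ?h x)"
      by (simp add: algebra_simps)
    then show ?case using d by simp
  qed
qed

text \<open>
  Splitting \<open>h (x + B)\<close> at the level \<open>B\<close> leaves, up to multiples of \<open>h\<close> that are as small as desired,
  only the contribution of \<open>Y \<le> B\<close>, which is at most about \<open>f x\<close>. The auxiliary function \<open>k\<close>
  allows the two alternative hypotheses on \<open>g\<close> to be treated at once.
\<close>

lemma convolution_le_factor:
  assumes F: "real_distribution F" and G: "real_distribution G"
    and A: "class_A c F" and S: "class_S c (F \<star> G)"
    and gh: "interval_prob c G \<in> o[at_top](interval_prob c (F \<star> G))"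
    and k: "almost_decreasing k" and gk: "interval_prob c G \<in> o[at_top](k)"
    and "0 \<le> C" and kh: "\<forall>\<^sub>F x in at_top. k x \<le> C * interval_prob c (F \<star> G) x"
    and "0 < e"
  shows "\<forall>\<^sub>F x in at_top. (1 - e) * interval_prob c (F \<star> G) x \<le> interval_prob c F x"
proof -
  let ?f = "interval_prob c F" and ?g = "interval_prob c G"
  let ?h = "interval_prob c (F \<star> G)"
  have H: "real_distribution (F \<star> G)" by (rule real_distribution_convolution[OF F G])
  have L: "class_L c (F \<star> G)" using S by (simp add: class_S_def)
  \<comment> \<open>The choice makes \<open>dC\<close> below true, in which \<open>d * C\<close> stems from the summand \<open>X \<le> B\<close>.\<close>
  define d where "d = min 1 (e / (3 + C))"
  have d: "0 < d" "d \<le> 1" using \<open>0 < e\<close> \<open>0 \<le> C\<close> by (auto simp: d_def)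
  have "d \<le> e / (3 + C)" by (simp add: d_def)
  then have "d * (3 + C) \<le> e" using \<open>0 \<le> C\<close> by (simp add: pos_le_divide_eq)
  moreover have "0 \<le> d * d" "0 \<le> e * d" using d \<open>0 < e\<close> by auto
  moreover have "(1 - d) * (1 - d) - d * C - (1 - e) * (1 + d) = e - d * (3 + C) + d * d + e * d"
    by (simp add: algebra_simps)
  ultimately have dC: "(1 - e) * (1 + d) \<le> (1 - d) * (1 - d) - d * C"
    by linarith
  have f2: "\<forall>\<^sub>F x in at_top. ?f x \<le> 2 * ?h x"
    using factor_le_convolution[OF F G A L, of 1] by simp
  have g2: "\<forall>\<^sub>F x in at_top. ?g x \<le> 2 * ?h x"
    using landau_o.smallD[OF gh, of 2] by (simp add: interval_prob_nonneg)
  obtain B where tail: "\<forall>\<^sub>F x in at_top.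
      joint_interval_prob c F G {B<..} {B<..} x \<le> d * ?h x"
    using eventually_joint_tail_le[OF F G H S _ d(1) f2 g2] by auto
  have left: "\<forall>\<^sub>F x in at_top. joint_interval_prob c F G {..B} UNIV x \<le> d * k (x - B)"
    using eventually_joint_atMost_le[OF F G smallo_almost_decreasing_bound[OF gk k d(1)]] .
  have right: "\<forall>\<^sub>F x in at_top. joint_interval_prob c G F {..B} UNIV x \<le> (1 + d) * ?f (x - B)"
    using eventually_joint_atMost_le[OF G F class_A_eventually_almost_monotone[OF A d(1)]] .
  have shift: "\<forall>\<^sub>F x in at_top. (1 - d) * ?h x \<le> ?h (x + B) \<and> ?h (x + B) \<le> (1 + d) * ?h x"
    using L d(1) unfolding class_L_def
    by (intro asymp_equiv_at_topD long_tailed_shift long_tailed_eventually_pos)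
  show ?thesis
    using eventually_at_top_shift[OF tail, of B] eventually_at_top_shift[OF left, of B]
      eventually_at_top_shift[OF right, of B] shift kh eventually_ge_at_top[of B]
  proof eventually_elim
    case (elim x)
    have "?h (x + B) \<le> d * k x + (1 + d) * ?f x + d * ?h (x + B)"
      using interval_prob_convolution_split[OF F G, of B "x + B" c] elim by simp
    moreover have "d * k x \<le> d * (C * ?h x)"
      using elim d by (intro mult_left_mono) auto
    moreover have "(1 - d) * ((1 - d) * ?h x) \<le> (1 - d) * ?h (x + B)"
      using elim d by (intro mult_left_mono) auto
    ultimately have "((1 - d) * (1 - d) - d * C) * ?h x \<le> (1 + d) * ?f x"
      by (simp add: algebra_simps)
    with mult_right_mono[OF dC interval_prob_nonneg[of c "F \<star> G" x]]
    have "(1 + d) * ((1 - e) * ?h x) \<le> (1 + d) * ?f x"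
      by (simp add: mult_ac)
    then show ?case using d by simp
  qed
qed

section \<open>Transfer of subexponentiality along asymptotic equivalence\<close>

lemma class_L_asymp_equiv:
  assumes F: "real_distribution F" and "0 < c" and L: "class_L c H"
    and eq: "interval_prob c F \<sim>[at_top] interval_prob c H"
  shows "class_L c F"
proof -
  let ?f = "interval_prob c F" and ?h = "interval_prob c H"
  have lt: "long_tailed ?h" using L by (simp add: class_L_def)
  have "\<forall>\<^sub>F x in at_top. (1 - 1 / 2) * ?h x \<le> ?f x \<and> ?f x \<le> (1 + 1 / 2) * ?h x"
    by (intro asymp_equiv_at_topD eq long_tailed_eventually_pos[OF lt]) simp
  with long_tailed_eventually_pos[OF lt] have "\<forall>\<^sub>F x in at_top. 0 < ?f x"
    by eventually_elim auto
  then obtain N where N: "\<And>x. N \<le> x \<Longrightarrow> 0 < ?f x"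
    by (auto simp: eventually_at_top_linorder)
  have shift: "(\<lambda>x. ?f (x + y)) \<sim>[at_top] ?f" for y
  proof -
    have "(\<lambda>x. ?f (x + y)) \<sim>[at_top] (\<lambda>x. ?h (x + y))"
      by (rule asymp_equiv_compose'[OF eq]) (simp add: filterlim_at_top eventually_at_top_shift)
    also have "\<dots> \<sim>[at_top] ?h" by (rule long_tailed_shift[OF lt])
    also have "\<dots> \<sim>[at_top] ?f" by (rule asymp_equiv_symI[OF eq])
    finally show ?thesis .
  qed
  show ?thesis
    unfolding class_L_def long_tailed_def
    using borel_measurable_interval_prob[OF F \<open>0 < c\<close>] shift
    by (intro conjI allI impI interval_prob_nonneg exI[of _ "max 1 N"]) (auto intro: N)
qed

text \<open>
  In the decomposition of \<open>F \<star> F\<close>, each of the two events with one bounded summand contributes one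
  copy of \<open>f\<close>: at least that much because \<open>f\<close> is long-tailed, and at most that much because it is
  almost monotone. The event with both summands large is negligible by comparison with \<open>H\<close>.
\<close>

lemma class_S_of_asymp_equiv_class_A:
  assumes F: "real_distribution F" and H: "real_distribution H" and "0 < c"
    and S: "class_S c H" and A: "class_A c F"
    and eq: "interval_prob c F \<sim>[at_top] interval_prob c H"
  shows "class_S c F"
proof -
  interpret F: real_distribution F by fact
  let ?f = "interval_prob c F" and ?h = "interval_prob c H"
  have LH: "class_L c H" using S by (simp add: class_S_def)
  have L: "class_L c F" by (rule class_L_asymp_equiv[OF F \<open>0 < c\<close> LH eq])
  then have lt: "long_tailed ?f" by (simp add: class_L_def)
  have fpos: "\<forall>\<^sub>F x in at_top. 0 < ?f x" by (rule long_tailed_eventually_pos[OF lt])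
  have hpos: "\<forall>\<^sub>F x in at_top. 0 < ?h x"
    using LH by (simp add: class_L_def long_tailed_eventually_pos)
  have "\<forall>\<^sub>F x in at_top. (1 - 1 / 2) * ?h x \<le> ?f x \<and> ?f x \<le> (1 + 1 / 2) * ?h x"
    by (intro asymp_equiv_at_topD eq hpos) simp
  then have cmp: "\<forall>\<^sub>F x in at_top. ?h x \<le> 2 * ?f x" "\<forall>\<^sub>F x in at_top. ?f x \<le> (3 / 2) * ?h x"
    by (auto elim: eventually_mono)
  have "interval_prob c (F \<star> F) \<sim>[at_top] (\<lambda>x. 2 * ?f x)"
  proof (rule asymp_equiv_at_topI)
    show "\<forall>\<^sub>F x in at_top. 0 < 2 * ?f x" using fpos by simp
  next
    fix e :: real assume "0 < e"
    then have "1 - e < 1" by simp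
    then have "\<forall>\<^sub>F B in at_top. 1 - e < cdf F B"
      by (rule order_tendstoD(1)[OF F.cdf_lim_at_top_prob])
    then obtain B where "1 - e < measure F {..B}"
      by (auto simp: eventually_at_top_linorder cdf_def)
    then have "\<forall>\<^sub>F x in at_top. (1 - e) * ?f x \<le> joint_interval_prob c F F {..B} UNIV x"
      by (intro eventually_ge_joint_of_long_tailed F L) auto
    then show "\<forall>\<^sub>F x in at_top. (1 - e) * (2 * ?f x) \<le> interval_prob c (F \<star> F) x"
      using eventually_ge_at_top[of "2 * B"]
    proof eventually_elim
      case (elim x)
      have "0 \<le> joint_interval_prob c F F {B<..} {B<..} x"
        by (simp add: joint_interval_prob_def)
      with elim interval_prob_convolution_split[OF F F, of B x c] show ?case by simp
    qed
  next
    fix e :: real assume "0 < e"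
    define d where "d = min 1 e / 4"
    have d: "0 < d" "d \<le> 1" "4 * d \<le> e" using \<open>0 < e\<close> by (auto simp: d_def)
    obtain B where tail: "\<forall>\<^sub>F x in at_top.
        joint_interval_prob c F F {B<..} {B<..} x \<le> d * ?h x"
      using eventually_joint_tail_le[OF F F H S _ d(1) cmp(2) cmp(2)] by auto
    have left: "\<forall>\<^sub>F x in at_top. joint_interval_prob c F F {..B} UNIV x \<le> (1 + d) * ?f (x - B)"
      using eventually_joint_atMost_le[OF F F class_A_eventually_almost_monotone[OF A d(1)]] .
    have shift: "\<forall>\<^sub>F x in at_top. (1 - d) * ?f x \<le> ?f (x + - B) \<and> ?f (x + - B) \<le> (1 + d) * ?f x"
      by (intro asymp_equiv_at_topD long_tailed_shift lt fpos d)
    show "\<forall>\<^sub>F x in at_top. interval_prob c (F \<star> F) x \<le> (1 + e) * (2 * ?f x)"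
      using tail left shift cmp(1) eventually_ge_at_top[of "2 * B"]
    proof eventually_elim
      case (elim x)
      have "interval_prob c (F \<star> F) x \<le> 2 * ((1 + d) * ?f (x - B)) + d * ?h x"
        using interval_prob_convolution_split[OF F F, of B x c] elim by simp
      also have "\<dots> \<le> 2 * ((1 + d) * ((1 + d) * ?f x)) + d * (2 * ?f x)"
        using elim d by (intro add_mono mult_left_mono) auto
      also have "\<dots> = (1 + 3 * d + d * d) * (2 * ?f x)"
        by (simp add: algebra_simps)
      also have "\<dots> \<le> (1 + e) * (2 * ?f x)"
      proof (rule mult_right_mono)
        have "d * d \<le> d" using d by (simp add: mult_left_le)
        then show "1 + 3 * d + d * d \<le> 1 + e" using d by linarith
      qed (simp add: interval_prob_nonneg)
      finally show ?case .
    qed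
  qed
  with L show ?thesis by (simp add: class_S_def)
qed

theorem proposition3p2:
  fixes c :: real and F G H :: "real measure"
  assumes "c > 0"
    and "real_distribution F" and "real_distribution G"
    and "H = (F \<star> G)"
    and "class_S c H"
    and "interval_prob c G \<in> o[at_top](interval_prob c H)"
    and "class_A c F"
    and "class_D c H \<or> interval_prob c G \<in> o[at_top](interval_prob c F)"
  shows "class_S c F"
proof -
  let ?f = "interval_prob c F" and ?g = "interval_prob c G" and ?h = "interval_prob c H"
  have H: "real_distribution H"
    using real_distribution_convolution[OF assms(2,3)] assms(4) by simp
  have L: "class_L c H" using assms(5) by (simp add: class_S_def)
  have upper: "\<forall>\<^sub>F x in at_top. ?f x \<le> (1 + e) * ?h x" if "0 < e" for e
    using factor_le_convolution[OF assms(2,3,7) _ that] L assms(4) by simp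
  obtain k where k: "almost_decreasing k" "?g \<in> o[at_top](k)"
      "\<forall>\<^sub>F x in at_top. k x \<le> 2 * ?h x"
  proof (cases "class_D c H")
    case True
    then show thesis
      using assms(6) that[of ?h] by (simp add: class_D_def interval_prob_nonneg)
  next
    case False
    then show thesis
      using assms(8) class_A_almost_decreasing[OF assms(7)] upper[of 1] that[of ?f] by simp
  qed
  have lower: "\<forall>\<^sub>F x in at_top. (1 - e) * ?h x \<le> ?f x" if "0 < e" for e
    using convolution_le_factor[OF assms(2,3,7) _ _ k(1,2) _ _ that, of 2]
      assms(4-6) k(3) by simp
  have "?f \<sim>[at_top] ?h"
    using L by (intro asymp_equiv_at_topI upper lower)
       (simp add: class_L_def long_tailed_eventually_pos)
  then show ?thesis
    by (rule class_S_of_asymp_equiv_class_A[OF assms(2) H assms(1,5,7)])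
qed

end
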